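(* Suppose $h_\lambda$ is differentiable with $L$-Lipschitz gradient, and set $\Delta=h_\lambda(\theta_0)-\inf_\theta h_\lambda(\theta)$. Let $\theta_0,\theta_1,\dots$ be generated by $T$ iterations $t=0,\dots,T-1$ of the stochastic gradient procedure described in the context, $\theta_{t+1}=\theta_t-\alpha_tg_t$, and let $G_t=\mathbb E[g_t\mid\pi_t,\theta_t]$. Assume that for all $t$, $\|G_t-\nabla h_\lambda(\theta_t)\|\le\delta$ and $\mathbb E[\|g_t-G_t\|^2\mid\pi_t,\theta_t]\le\sigma^2$, where $\sigma>0$. 1. If $T<\frac{2\Delta L}{\sigma^2}$ and $\alpha_t=\frac1L$ for all $t$, then $$\frac1T\sum_{t=0}^{T-1}\mathbb E\big[\|\nabla h_\lambda(\theta_t)\|^2\big]\le\frac{2L\Delta}{T}+\delta^2+\sigma^2.$$ 2. If $T\ge\frac{2\Delta L}{\sigma^2}$ and $\alpha_t=\sqrt{\frac{2\Delta}{L\sigma^2T}}$ for all $t$, then $$\frac1T\sum_{t=0}^{T-1}\mathbb E\big[\|\nabla h_\lambda(\theta_t)\|^2\big]\le\sigma\sqrt{\frac{8L\Delta}{T}}+\delta^2.$$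
   Context: $\mathbf q$ is a probability distribution on a space $\mathcal X$, $\mathbf p$ a probability distribution on $\mathcal Y\subseteq\mathbb R^d$ (written as densities or probability mass functions); $\{G_\theta\}$ is a family of one-to-one maps $G_\theta:\mathcal X\to\mathbb R^d$ with parameter $\theta$ ranging over a Euclidean space (the updates are unconstrained), $c:\mathbb R^d\times\mathbb R^d\to\mathbb R$ is a cost function, $\lambda>0$, and $\|\cdot\|$ is the Euclidean norm. $\Pi(\mathbf p,\mathbf q)$ is the set of joint distributions $\pi(x,y)$ on $\mathcal X\times\mathcal Y$ with $x$-marginal $\mathbf q$ and $y$-marginal $\mathbf p$. $I$ is either the KL regularizer $I(\pi)=\int\int\pi\log\frac{\pi(x,y)}{\mathbf q(x)\mathbf p(y)}dx\,dy$ or the norm-2 regularizer $I(\pi)=\frac12\int\int\frac{\pi(x,y)^2}{\mathbf q(x)\mathbf p(y)}dx\,dy$, and $h_\lambda(\theta)=\min_{\pi\in\Pi(\mathbf p,\mathbf q)}\int\int\pi(x,y)c(G_\theta(x),y)\,dx\,dy+\lambda I(\pi)$. Procedure (input: initial point $\theta_0$, batch size $S$, step sizes $\alpha_t$). At iteration $t$: (a) an oracle returns an $\epsilon$-approximate maximizer $(\phi_t,\psi_t)$ of the dual problem $\max_{\phi,\psi}\mathbb E_{\mathbf q}[\phi(x)]-\mathbb E_{\mathbf p}[\psi(y)]-\mathbb E_{\mathbf q\times\mathbf p}[f_\lambda(\phi(x)-\psi(y)-c(G_{\theta_t}(x),y))]$, where $f_\lambda(v)=\frac\lambda e e^{v/\lambda}$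 (KL) or $f_\lambda(v)=\frac{(v_+)^2}{2\lambda}$ (norm-2), and one sets $\pi_t(x,y)=\mathbf q(x)\mathbf p(y)M\big(\phi_t(x)-\psi_t(y)-c(G_{\theta_t}(x),y)\big)$ with $M(v)=\frac1ee^{v/\lambda}$ (KL) or $M(v)=\frac{v_+}{\lambda}$ (norm-2); (b) fresh i.i.d. samples $x_t^1,\dots,x_t^S\sim\mathbf q$ and $y_t^1,\dots,y_t^S\sim\mathbf p$ are drawn, independently of everything before (including $\theta_0,\dots,\theta_t,\pi_0,\dots,\pi_t$), and $$g_t=\frac1{S^2}\sum_{i,j=1}^S\frac{\pi_t(x_t^i,y_t^j)}{\mathbf q(x_t^i)\mathbf p(y_t^j)}\nabla_\theta c(G_{\theta_t}(x_t^i),y_t^j);$$ (c) $\theta_{t+1}=\theta_t-\alpha_tg_t$. Because the samples are fresh, conditioning $g_t$ on the whole history $(\theta_0,\dots,\theta_t,\pi_0,\dots,\pi_t)$ is the same as conditioning on $(\pi_t,\theta_t)$. *)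

theory Defs
  imports "HOL-Probability.Probability"
begin

section \<open>Gradients, extended integrals, conditional expectations\<close>

text \<open>Meaningful where \<open>f\<close> is differentiable; the gradient is then unique.\<close>

definition gradient :: "('b::euclidean_space \<Rightarrow> real) \<Rightarrow> 'b \<Rightarrow> 'b" where
  "gradient f x = (THE D. GDERIV f x :> D)"

text \<open>Unlike the Bochner integral, this does not return 0 for a function that is not integrable:
  it is infinite if exactly one of the positive and negative parts has an infinite integral. If both
  do (the integral is undefined), the value is \<open>\<infinity> - \<infinity> = \<infinity>\<close>, so an undefined value never
  competes in a minimization.\<close>

definition ext_integral :: "'a measure \<Rightarrow> ('a \<Rightarrow> real) \<Rightarrow> ereal" where
  "ext_integral M f =
     enn2ereal (\<integral>\<^sup>+z. ennreal (f z) \<partial>M) - enn2ereal (\<integral>\<^sup>+z. ennreal (- f z) \<partial>M)"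

text \<open>Conditional expectation of a random vector, taken coordinatewise.\<close>

definition vec_cond_exp :: "'a measure \<Rightarrow> 'a measure \<Rightarrow> ('a \<Rightarrow> 'b::euclidean_space) \<Rightarrow> 'a \<Rightarrow> 'b" where
  "vec_cond_exp M F f = (\<lambda>w. \<Sum>b\<in>Basis. real_cond_exp M F (\<lambda>w. f w \<bullet> b) w *\<^sub>R b)"


section \<open>Regularized optimal transport\<close>

text \<open>The distributions \<open>\<q>\<close> on \<open>\<X>\<close> and \<open>\<p>\<close> on \<open>\<Y>\<close> are given by their densities
  \<open>q\<close>, \<open>p\<close> with respect to reference measures \<open>\<mu>\<close>, \<open>\<nu>\<close> with \<open>space \<mu> = \<X>\<close> and \<open>space \<nu> = \<Y>\<close>
  (Lebesgue measure for densities, counting measure for probability mass functions). A joint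
  distribution is given by its density with respect to the product \<open>\<mu> \<Otimes>\<^sub>M \<nu>\<close>.\<close>

datatype regularizer = KL | Norm2

definition is_density :: "'a measure \<Rightarrow> ('a \<Rightarrow> real) \<Rightarrow> bool" where
  "is_density \<mu> q \<longleftrightarrow>
     q \<in> borel_measurable \<mu> \<and> (\<forall>x\<in>space \<mu>. 0 \<le> q x) \<and> (\<integral>\<^sup>+x. ennreal (q x) \<partial>\<mu>) = 1"

definition couplings ::
  "'x measure \<Rightarrow> ('x \<Rightarrow> real) \<Rightarrow> 'y measure \<Rightarrow> ('y \<Rightarrow> real) \<Rightarrow> ('x \<times> 'y \<Rightarrow> real) set" where
  "couplings \<mu> q \<nu> p = {\<pi>.
     \<pi> \<in> borel_measurable (\<mu> \<Otimes>\<^sub>M \<nu>) \<and>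
     (\<forall>z\<in>space (\<mu> \<Otimes>\<^sub>M \<nu>). 0 \<le> \<pi> z) \<and>
     (AE x in \<mu>. (\<integral>\<^sup>+y. ennreal (\<pi> (x, y)) \<partial>\<nu>) = ennreal (q x)) \<and>
     (AE y in \<nu>. (\<integral>\<^sup>+x. ennreal (\<pi> (x, y)) \<partial>\<mu>) = ennreal (p y))}"

text \<open>For a coupling \<open>\<pi>\<close>, the set where \<open>q x * p y = 0 < \<pi> (x, y)\<close> is a null set, and where
  \<open>\<pi> (x, y) = 0\<close> both integrands below are 0, as they should be.\<close>

definition reg_value ::
  "regularizer \<Rightarrow> 'x measure \<Rightarrow> ('x \<Rightarrow> real) \<Rightarrow> 'y measure \<Rightarrow> ('y \<Rightarrow> real) \<Rightarrow> ('x \<times> 'y \<Rightarrow> real) \<Rightarrow> ereal"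
  where
  "reg_value r \<mu> q \<nu> p \<pi> = (case r of
     KL \<Rightarrow> ext_integral (\<mu> \<Otimes>\<^sub>M \<nu>) (\<lambda>(x, y). \<pi> (x, y) * ln (\<pi> (x, y) / (q x * p y)))
   | Norm2 \<Rightarrow> ereal (1/2) * ext_integral (\<mu> \<Otimes>\<^sub>M \<nu>) (\<lambda>(x, y). (\<pi> (x, y))\<^sup>2 / (q x * p y)))"

definition ot_objective ::
  "regularizer \<Rightarrow> real \<Rightarrow> 'x measure \<Rightarrow> ('x \<Rightarrow> real) \<Rightarrow> 'y measure \<Rightarrow> ('y \<Rightarrow> real) \<Rightarrow>
   ('x \<Rightarrow> 'z) \<Rightarrow> ('z \<Rightarrow> 'y \<Rightarrow> real) \<Rightarrow> ('x \<times> 'y \<Rightarrow> real) \<Rightarrow> ereal" where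
  "ot_objective r lam \<mu> q \<nu> p G c \<pi> =
     ext_integral (\<mu> \<Otimes>\<^sub>M \<nu>) (\<lambda>(x, y). \<pi> (x, y) * c (G x) y) + ereal lam * reg_value r \<mu> q \<nu> p \<pi>"

text \<open>The value \<open>h\<^sub>\<lambda>(\<theta>)\<close>, for \<open>G = G\<^sub>\<theta>\<close>. That this infimum is a minimum with a finite value is
  the assumption \<open>min_exists\<close> below.\<close>

definition ot_value ::
  "regularizer \<Rightarrow> real \<Rightarrow> 'x measure \<Rightarrow> ('x \<Rightarrow> real) \<Rightarrow> 'y measure \<Rightarrow> ('y \<Rightarrow> real) \<Rightarrow>
   ('x \<Rightarrow> 'z) \<Rightarrow> ('z \<Rightarrow> 'y \<Rightarrow> real) \<Rightarrow> real" where
  "ot_value r lam \<mu> q \<nu> p G c =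
     real_of_ereal (INF \<pi>\<in>couplings \<mu> q \<nu> p. ot_objective r lam \<mu> q \<nu> p G c \<pi>)"


section \<open>The dual problem and its approximate solutions\<close>

definition reg_f :: "regularizer \<Rightarrow> real \<Rightarrow> real \<Rightarrow> real" where
  "reg_f r lam v = (case r of
     KL \<Rightarrow> lam / exp 1 * exp (v / lam)
   | Norm2 \<Rightarrow> (max v 0)\<^sup>2 / (2 * lam))"

definition reg_M :: "regularizer \<Rightarrow> real \<Rightarrow> real \<Rightarrow> real" where
  "reg_M r lam v = (case r of
     KL \<Rightarrow> 1 / exp 1 * exp (v / lam)
   | Norm2 \<Rightarrow> max v 0 / lam)"

definition dual_admissible ::
  "regularizer \<Rightarrow> real \<Rightarrow> 'x measure \<Rightarrow> ('x \<Rightarrow> real) \<Rightarrow> 'y measure \<Rightarrow> ('y \<Rightarrow> real) \<Rightarrow>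
   ('x \<Rightarrow> 'z) \<Rightarrow> ('z \<Rightarrow> 'y \<Rightarrow> real) \<Rightarrow> ('x \<Rightarrow> real) \<Rightarrow> ('y \<Rightarrow> real) \<Rightarrow> bool" where
  "dual_admissible r lam \<mu> q \<nu> p G c \<phi> \<psi> \<longleftrightarrow>
     integrable (density \<mu> q) \<phi> \<and> integrable (density \<nu> p) \<psi> \<and>
     integrable (density \<mu> q \<Otimes>\<^sub>M density \<nu> p) (\<lambda>(x, y). reg_f r lam (\<phi> x - \<psi> y - c (G x) y))"

definition dual_objective ::
  "regularizer \<Rightarrow> real \<Rightarrow> 'x measure \<Rightarrow> ('x \<Rightarrow> real) \<Rightarrow> 'y measure \<Rightarrow> ('y \<Rightarrow> real) \<Rightarrow>
   ('x \<Rightarrow> 'z) \<Rightarrow> ('z \<Rightarrow> 'y \<Rightarrow> real) \<Rightarrow> ('x \<Rightarrow> real) \<Rightarrow> ('y \<Rightarrow> real) \<Rightarrow> real" where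
  "dual_objective r lam \<mu> q \<nu> p G c \<phi> \<psi> =
     (\<integral>x. \<phi> x \<partial>density \<mu> q) - (\<integral>y. \<psi> y \<partial>density \<nu> p)
     - (\<integral>(x, y). reg_f r lam (\<phi> x - \<psi> y - c (G x) y) \<partial>(density \<mu> q \<Otimes>\<^sub>M density \<nu> p))"

definition approx_dual_maximizer ::
  "regularizer \<Rightarrow> real \<Rightarrow> 'x measure \<Rightarrow> ('x \<Rightarrow> real) \<Rightarrow> 'y measure \<Rightarrow> ('y \<Rightarrow> real) \<Rightarrow>
   ('x \<Rightarrow> 'z) \<Rightarrow> ('z \<Rightarrow> 'y \<Rightarrow> real) \<Rightarrow> real \<Rightarrow> ('x \<Rightarrow> real) \<Rightarrow> ('y \<Rightarrow> real) \<Rightarrow> bool" where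
  "approx_dual_maximizer r lam \<mu> q \<nu> p G c \<epsilon> \<phi> \<psi> \<longleftrightarrow>
     dual_admissible r lam \<mu> q \<nu> p G c \<phi> \<psi> \<and>
     (\<forall>\<phi>' \<psi>'. dual_admissible r lam \<mu> q \<nu> p G c \<phi>' \<psi>' \<longrightarrow>
        dual_objective r lam \<mu> q \<nu> p G c \<phi>' \<psi>' \<le> dual_objective r lam \<mu> q \<nu> p G c \<phi> \<psi> + \<epsilon>)"

definition plan_of_duals ::
  "regularizer \<Rightarrow> real \<Rightarrow> ('x \<Rightarrow> real) \<Rightarrow> ('y \<Rightarrow> real) \<Rightarrow>
   ('x \<Rightarrow> 'z) \<Rightarrow> ('z \<Rightarrow> 'y \<Rightarrow> real) \<Rightarrow> ('x \<Rightarrow> real) \<Rightarrow> ('y \<Rightarrow> real) \<Rightarrow> 'x \<times> 'y \<Rightarrow> real" where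
  "plan_of_duals r lam q p G c \<phi> \<psi> =
     (\<lambda>(x, y). q x * p y * reg_M r lam (\<phi> x - \<psi> y - c (G x) y))"


section \<open>The stochastic gradient procedure\<close>

definition stoch_grad ::
  "('x \<Rightarrow> real) \<Rightarrow> ('y \<Rightarrow> real) \<Rightarrow> ('b::euclidean_space \<Rightarrow> 'x \<Rightarrow> 'z) \<Rightarrow> ('z \<Rightarrow> 'y \<Rightarrow> real) \<Rightarrow>
   nat \<Rightarrow> ('x \<times> 'y \<Rightarrow> real) \<Rightarrow> 'b \<Rightarrow> (nat \<Rightarrow> 'x) \<Rightarrow> (nat \<Rightarrow> 'y) \<Rightarrow> 'b" where
  "stoch_grad q p G c S \<pi> \<eta> xs ys =
     (1 / (real S)\<^sup>2) *\<^sub>R (\<Sum>i=1..S. \<Sum>j=1..S.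
        (\<pi> (xs i, ys j) / (q (xs i) * p (ys j))) *\<^sub>R gradient (\<lambda>\<zeta>. c (G \<zeta> (xs i)) (ys j)) \<eta>)"

text \<open>The sigma-algebra generated by \<open>(\<pi>\<^sub>t, \<theta>\<^sub>t)\<close>, where the random function \<open>\<pi>\<^sub>t\<close> is a random
  element of the product space of all functions \<open>\<X> \<times> \<Y> \<rightarrow> \<real>\<close>.\<close>

definition plan_param_algebra ::
  "'w measure \<Rightarrow> 'x measure \<Rightarrow> 'y measure \<Rightarrow> ('w \<Rightarrow> 'x \<times> 'y \<Rightarrow> real) \<Rightarrow> ('w \<Rightarrow> 'b::euclidean_space) \<Rightarrow>
   'w measure" where
  "plan_param_algebra P \<mu> \<nu> \<pi> \<theta> =
     vimage_algebra (space P)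
       (\<lambda>w. (restrict (\<pi> w) (space \<mu> \<times> space \<nu>), \<theta> w))
       ((\<Pi>\<^sub>M z\<in>space \<mu> \<times> space \<nu>. borel) \<Otimes>\<^sub>M borel)"

locale ot_setting =
  fixes r :: regularizer and lam :: real
    and \<mu> :: "'x measure" and q :: "'x \<Rightarrow> real"
    and Y :: "(real ^ 'd) set" and \<nu> :: "(real ^ 'd) measure" and p :: "real ^ 'd \<Rightarrow> real"
    and G :: "'b::euclidean_space \<Rightarrow> 'x \<Rightarrow> real ^ 'd"
    and c :: "real ^ 'd \<Rightarrow> real ^ 'd \<Rightarrow> real"
  assumes lam_pos: "0 < lam"
    and reference_x: "sigma_finite_measure \<mu>"
    and reference_y: "sigma_finite_measure \<nu>"
    and space_y: "space \<nu> = Y" and sets_y: "sets \<nu> = sets (restrict_space borel Y)"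
    and density_q: "is_density \<mu> q"
    and density_p: "is_density \<nu> p"
    and one_to_one: "inj_on (G \<eta>) (space \<mu>)"
    and measurable_G: "(\<lambda>(\<eta>, x). G \<eta> x) \<in> borel_measurable (borel \<Otimes>\<^sub>M \<mu>)"
    and measurable_c: "(\<lambda>(u, v). c u v) \<in> borel_measurable (borel \<Otimes>\<^sub>M borel)"
    and differentiable_cost:
      "x \<in> space \<mu> \<Longrightarrow> y \<in> Y \<Longrightarrow> (\<lambda>\<zeta>. c (G \<zeta> x) y) differentiable (at \<eta>)"
    and min_exists:
      "\<exists>\<pi>\<in>couplings \<mu> q \<nu> p. \<bar>ot_objective r lam \<mu> q \<nu> p (G \<eta>) c \<pi>\<bar> \<noteq> \<infinity> \<and>
         (\<forall>\<pi>'\<in>couplings \<mu> q \<nu> p.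
            ot_objective r lam \<mu> q \<nu> p (G \<eta>) c \<pi> \<le> ot_objective r lam \<mu> q \<nu> p (G \<eta>) c \<pi>')"

text \<open>\<open>hist t\<close> collects everything that happens before the samples of iteration \<open>t\<close> are drawn.
  The random functions \<open>\<phi> t\<close>, \<open>\<psi> t\<close> are required to be jointly measurable over \<open>hist t\<close>:
  independence of the samples from the point evaluations of \<open>\<phi> t\<close> and \<open>\<psi> t\<close> alone would not
  exclude, e.g., that \<open>\<phi> t\<close> is the indicator of the (atomless) sample itself.\<close>

locale ot_sgd = ot_setting r lam \<mu> q Y \<nu> p G c + prob_space P
  for r :: regularizer and lam :: real
    and \<mu> :: "'x measure" and q :: "'x \<Rightarrow> real"
    and Y :: "(real ^ 'd) set" and \<nu> :: "(real ^ 'd) measure" and p :: "real ^ 'd \<Rightarrow> real"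
    and G :: "'b::euclidean_space \<Rightarrow> 'x \<Rightarrow> real ^ 'd"
    and c :: "real ^ 'd \<Rightarrow> real ^ 'd \<Rightarrow> real"
    and P :: "'w measure" +
  fixes hist :: "nat \<Rightarrow> 'w measure"
    and T :: nat and S :: nat and \<alpha> :: "nat \<Rightarrow> real" and \<epsilon> :: real and \<theta>0 :: 'b
    and \<phi> :: "nat \<Rightarrow> 'w \<Rightarrow> 'x \<Rightarrow> real" and \<psi> :: "nat \<Rightarrow> 'w \<Rightarrow> real ^ 'd \<Rightarrow> real"
    and \<pi> :: "nat \<Rightarrow> 'w \<Rightarrow> 'x \<times> (real ^ 'd) \<Rightarrow> real"
    and xs :: "nat \<Rightarrow> nat \<Rightarrow> 'w \<Rightarrow> 'x" and ys :: "nat \<Rightarrow> nat \<Rightarrow> 'w \<Rightarrow> real ^ 'd"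
    and g :: "nat \<Rightarrow> 'w \<Rightarrow> 'b" and \<theta> :: "nat \<Rightarrow> 'w \<Rightarrow> 'b"
  assumes iterations_pos: "0 < T" and batch_pos: "0 < S"
    and hist_sub: "t < T \<Longrightarrow> subalgebra P (hist t)"
    and hist_mono: "s \<le> t \<Longrightarrow> t < T \<Longrightarrow> sets (hist s) \<subseteq> sets (hist t)"
    and hist_samples_x: "s < t \<Longrightarrow> t < T \<Longrightarrow> i \<in> {1..S} \<Longrightarrow> xs s i \<in> hist t \<rightarrow>\<^sub>M \<mu>"
    and hist_samples_y: "s < t \<Longrightarrow> t < T \<Longrightarrow> i \<in> {1..S} \<Longrightarrow> ys s i \<in> hist t \<rightarrow>\<^sub>M \<nu>"
    and hist_param: "t < T \<Longrightarrow> \<theta> t \<in> borel_measurable (hist t)"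
    and hist_phi: "t < T \<Longrightarrow> (\<lambda>(w, x). \<phi> t w x) \<in> borel_measurable (hist t \<Otimes>\<^sub>M \<mu>)"
    and hist_psi: "t < T \<Longrightarrow> (\<lambda>(w, y). \<psi> t w y) \<in> borel_measurable (hist t \<Otimes>\<^sub>M \<nu>)"
    and oracle_step:
      "t < T \<Longrightarrow> AE w in P. approx_dual_maximizer r lam \<mu> q \<nu> p (G (\<theta> t w)) c \<epsilon> (\<phi> t w) (\<psi> t w)"
    and plan: "t < T \<Longrightarrow> w \<in> space P \<Longrightarrow>
      \<pi> t w = plan_of_duals r lam q p (G (\<theta> t w)) c (\<phi> t w) (\<psi> t w)"
    and samples_x: "t < T \<Longrightarrow> i \<in> {1..S} \<Longrightarrow> distributed P \<mu> (xs t i) q"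
    and samples_y: "t < T \<Longrightarrow> j \<in> {1..S} \<Longrightarrow> distributed P \<nu> (ys t j) p"
    and indep_x: "t < T \<Longrightarrow> indep_vars (\<lambda>_. \<mu>) (xs t) {1..S}"
    and indep_y: "t < T \<Longrightarrow> indep_vars (\<lambda>_. \<nu>) (ys t) {1..S}"
    and indep_x_y: "t < T \<Longrightarrow>
      indep_set
        (sets (vimage_algebra (space P) (\<lambda>w. \<lambda>i\<in>{1..S}. xs t i w) (\<Pi>\<^sub>M i\<in>{1..S}. \<mu>)))
        (sets (vimage_algebra (space P) (\<lambda>w. \<lambda>j\<in>{1..S}. ys t j w) (\<Pi>\<^sub>M j\<in>{1..S}. \<nu>)))"
    and fresh: "t < T \<Longrightarrow>
      indep_set (sets (hist t))
        (sets (vimage_algebra (space P)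
          (\<lambda>w. (\<lambda>i\<in>{1..S}. xs t i w, \<lambda>j\<in>{1..S}. ys t j w))
          ((\<Pi>\<^sub>M i\<in>{1..S}. \<mu>) \<Otimes>\<^sub>M (\<Pi>\<^sub>M j\<in>{1..S}. \<nu>))))"
    and stochastic_gradient: "t < T \<Longrightarrow> w \<in> space P \<Longrightarrow>
      g t w = stoch_grad q p G c S (\<pi> t w) (\<theta> t w) (\<lambda>i. xs t i w) (\<lambda>j. ys t j w)"
    and initial: "w \<in> space P \<Longrightarrow> \<theta> 0 w = \<theta>0"
    and update: "t < T \<Longrightarrow> w \<in> space P \<Longrightarrow> \<theta> (Suc t) w = \<theta> t w - \<alpha> t *\<^sub>R g t w"

end

theory Submission
  imports Defs
begin

text \<open>Write \<open>D = gradient h (\<theta> t)\<close> and \<open>B = Gbar t\<close>. The quadratic upper bound for \<open>h\<close>,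
  with \<open>\<theta> (Suc t) = \<theta> t - a *\<^sub>R g t\<close> and \<open>g t\<close> conditionally centred at \<open>B\<close>, gives in expectation
  \<open>E h(\<theta> (Suc t)) \<le> E h(\<theta> t) - a E(D \<bullet> B) + L a\<^sup>2 / 2 * (\<sigma>\<^sup>2 + E |B|\<^sup>2)\<close>. For \<open>a L \<le> 1\<close> the right side is
  at most \<open>E h(\<theta> t) + a / 2 * (E |B - D|\<^sup>2 - E |D|\<^sup>2) + L a\<^sup>2 \<sigma>\<^sup>2 / 2\<close>; telescoping bounds the mean of
  the \<open>E |D|\<^sup>2\<close> by \<open>2 \<Delta> / (a T) + \<delta>\<^sup>2 + L a \<sigma>\<^sup>2\<close>. No integrability is assumed: the iterates are square
  integrable by induction, as \<open>\<theta> 0\<close> is constant, \<open>gradient h\<close> grows at most linearly, and \<open>g t\<close>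
  stays within square integrable distance of it by the bias and variance bounds.\<close>

section \<open>Gradients of smooth functions\<close>

text \<open>The derivative at a point is unique, and the functional
  \<open>\<lambda>u. u \<bullet> D\<close> determines \<open>D\<close>.\<close>

lemma gradient_eqI:
  assumes "GDERIV f x :> D"
  shows "gradient f x = D"
  unfolding gradient_def
proof (rule the_equality)
  fix D' assume "GDERIV f x :> D'"
  then have "(\<lambda>u. u \<bullet> D') = (\<lambda>u. u \<bullet> D)"
    using assms unfolding gderiv_def by (rule has_derivative_unique)
  then show "D' = D"
    by (metis inner_commute vector_eq_ldot)
qed (fact assms)

text \<open>In finite dimension every linear functional is an inner product; the coordinates of the
  representing vector are the values of the derivative on \<open>Basis\<close>. This existence makes
  the definite description in \<open>gradient\<close> meaningful.\<close>

lemma GDERIV_gradient: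
  fixes f :: "'b::euclidean_space \<Rightarrow> real"
  assumes "f differentiable (at x)"
  shows "GDERIV f x :> gradient f x"
proof -
  obtain f' where f': "(f has_derivative f') (at x)"
    using assms unfolding differentiable_def by blast
  then interpret bounded_linear f' by (rule has_derivative_bounded_linear)
  have "f' = (\<lambda>u. u \<bullet> (\<Sum>b\<in>Basis. f' b *\<^sub>R b))"
  proof
    fix u
    have "f' u = f' (\<Sum>b\<in>Basis. (u \<bullet> b) *\<^sub>R b)"
      by (simp add: euclidean_representation)
    also have "\<dots> = u \<bullet> (\<Sum>b\<in>Basis. f' b *\<^sub>R b)"
      by (simp add: sum scaleR inner_sum_right mult.commute)
    finally show "f' u = u \<bullet> (\<Sum>b\<in>Basis. f' b *\<^sub>R b)" .
  qed
  with f' have "GDERIV f x :> (\<Sum>b\<in>Basis. f' b *\<^sub>R b)"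
    unfolding gderiv_def by metis
  then show ?thesis
    using gradient_eqI by metis
qed

lemma DERIV_along_line:
  fixes f :: "'b::euclidean_space \<Rightarrow> real"
  assumes "f differentiable (at (x + s *\<^sub>R d))"
  shows "((\<lambda>s. f (x + s *\<^sub>R d)) has_real_derivative (d \<bullet> gradient f (x + s *\<^sub>R d))) (at s)"
proof -
  have 1: "((\<lambda>s. x + s *\<^sub>R d) has_derivative (\<lambda>u. u *\<^sub>R d)) (at s)"
    by (auto intro!: derivative_eq_intros)
  have "(f has_derivative (\<lambda>u. u \<bullet> gradient f (x + s *\<^sub>R d))) (at (x + s *\<^sub>R d))"
    using GDERIV_gradient[OF assms] unfolding gderiv_def .
  from has_derivative_compose[OF 1 this] show ?thesis
    by (simp add: has_field_derivative_def mult.commute[of _ "d \<bullet> _"] ext)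
qed

text \<open>The limit runs along a sequence because measurability passes to limits of sequences;
  this later gives the measurability of gradients at random points.\<close>

lemma gradient_difference_quotient:
  fixes f :: "'b::euclidean_space \<Rightarrow> real"
  assumes "f differentiable (at x)"
  shows "(\<lambda>n. (f (x + (1 / real (Suc n)) *\<^sub>R d) - f x) * real (Suc n))
           \<longlonglongrightarrow> gradient f x \<bullet> d"
proof -
  have "((\<lambda>s. f (x + s *\<^sub>R d)) has_real_derivative (d \<bullet> gradient f x)) (at 0)"
    using DERIV_along_line[of f x 0 d] assms by simp
  then have "(\<lambda>s. (f (x + s *\<^sub>R d) - f x) / s) \<midarrow>0\<rightarrow> d \<bullet> gradient f x"
    by (simp add: DERIV_def)
  moreover have "filterlim (\<lambda>n. 1 / real (Suc n)) (at 0) sequentially"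
    unfolding filterlim_at using LIMSEQ_inverse_real_of_nat
    by (auto simp: inverse_eq_divide)
  ultimately have "(\<lambda>n. (f (x + (1 / real (Suc n)) *\<^sub>R d) - f x) / (1 / real (Suc n)))
      \<longlonglongrightarrow> d \<bullet> gradient f x"
    by (rule filterlim_compose)
  then show ?thesis
    by (simp add: inner_commute)
qed

text \<open>Serves the degenerate case \<open>\<Delta> = 0\<close>, in which the starting point is a
  global minimizer.\<close>

lemma gradient_eq_0_of_minimum:
  fixes f :: "'b::euclidean_space \<Rightarrow> real"
  assumes "f differentiable (at x)" and "\<And>y. f x \<le> f y"
  shows "gradient f x = 0"
proof -
  have "(\<lambda>u. u \<bullet> gradient f x) = (\<lambda>u. 0)"
    by (rule differential_zero_maxmin[of x UNIV f])
      (use GDERIV_gradient[OF assms(1)] assms(2) in \<open>auto simp: gderiv_def\<close>)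
  then show ?thesis
    by (metis inner_eq_zero_iff)
qed

text \<open>The descent lemma, obtained from the sign of a derivative along the segment from
  \<open>x\<close> to \<open>x + d\<close> rather than by integrating the gradient.\<close>

lemma lipschitz_gradient_upper_bound:
  fixes f :: "'b::euclidean_space \<Rightarrow> real"
  assumes diff: "\<And>x. f differentiable (at x)" and lip: "L-lipschitz_on UNIV (gradient f)"
  shows "f (x + d) \<le> f x + d \<bullet> gradient f x + L / 2 * (norm d)\<^sup>2"
proof -
  \<comment> \<open>Up to the constant \<open>f x\<close>, this is \<open>f\<close> on the segment
    minus the claimed quadratic bound, with \<open>d\<close> scaled by \<open>s\<close>. The claim
    is \<open>k 1 \<le> k 0\<close>.\<close>
  define k where
    "k = (\<lambda>s. f (x + s *\<^sub>R d) - s * (d \<bullet> gradient f x) - L / 2 * (norm d)\<^sup>2 * s\<^sup>2)"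
  have "k 1 \<le> k 0"
  proof (rule DERIV_nonpos_imp_nonincreasing[of 0 1 k])
    fix s :: real assume s: "0 \<le> s" "s \<le> 1"
    have "(k has_real_derivative
        (d \<bullet> gradient f (x + s *\<^sub>R d) - d \<bullet> gradient f x - L * (norm d)\<^sup>2 * s)) (at s)"
      unfolding k_def by (auto intro!: derivative_eq_intros DERIV_along_line diff)
    moreover have "d \<bullet> gradient f (x + s *\<^sub>R d) - d \<bullet> gradient f x
        \<le> norm d * norm (gradient f (x + s *\<^sub>R d) - gradient f x)"
      by (metis inner_diff_right norm_cauchy_schwarz)
    \<comment> \<open>The points lie at distance \<open>s * norm d\<close>, so after Cauchy-Schwarz
      the Lipschitz condition yields \<open>L * (norm d)\<^sup>2 * s\<close>, which is the
      derivative of the quadratic term in \<open>k\<close>.\<close>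
    moreover have "norm (gradient f (x + s *\<^sub>R d) - gradient f x) \<le> L * (s * norm d)"
      using lipschitz_onD[OF lip, of "x + s *\<^sub>R d" x] s by (simp add: dist_norm)
    then have "norm d * norm (gradient f (x + s *\<^sub>R d) - gradient f x)
        \<le> norm d * (L * (s * norm d))"
      by (rule mult_left_mono) simp
    ultimately show "\<exists>y. DERIV k s :> y \<and> y \<le> 0"
      by (force simp: power2_eq_square algebra_simps)
  qed simp
  then show ?thesis by (simp add: k_def)
qed

section \<open>Square integrable random vectors\<close>

text \<open>Measurability is a separate conjunct, since measurability of the squared norm does not
  imply that of the vector.\<close>

definition square_integrable :: "'a measure \<Rightarrow> ('a \<Rightarrow> 'b::euclidean_space) \<Rightarrow> bool" where
  "square_integrable M f \<longleftrightarrow>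
     f \<in> borel_measurable M \<and> integrable M (\<lambda>w. (norm (f w))\<^sup>2)"

lemma square_integrable_measurable [measurable_dest]:
  "square_integrable M f \<Longrightarrow> f \<in> borel_measurable M"
  by (simp add: square_integrable_def)

lemma square_integrable_cong:
  assumes "\<And>w. w \<in> space M \<Longrightarrow> f w = g w"
  shows "square_integrable M f \<longleftrightarrow> square_integrable M g"
  unfolding square_integrable_def using assms
  by (intro conj_cong measurable_cong Bochner_Integration.integrable_cong) auto

lemma square_integrable_bound:
  assumes "f \<in> borel_measurable M" and "integrable M k"
    and "AE w in M. (norm (f w))\<^sup>2 \<le> k w"
  shows "square_integrable M f"
  unfolding square_integrable_def
proof
  show "integrable M (\<lambda>w. (norm (f w))\<^sup>2)"
    by (rule Bochner_Integration.integrable_bound[OF assms(2)]) (use assms in auto)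
qed (fact assms)

lemma norm_add_squared_le: "(norm (a + b))\<^sup>2 \<le> 2 * (norm a)\<^sup>2 + 2 * (norm b)\<^sup>2"
proof -
  have "(norm (a + b))\<^sup>2 \<le> (norm a + norm b)\<^sup>2"
    by (intro power_mono norm_triangle_ineq) simp
  also have "\<dots> \<le> 2 * (norm a)\<^sup>2 + 2 * (norm b)\<^sup>2"
    using sum_squares_bound[of "norm a" "norm b"] by (simp add: power2_sum)
  finally show ?thesis .
qed

lemma square_integrable_add:
  assumes "square_integrable M f" and "square_integrable M g"
  shows "square_integrable M (\<lambda>w. f w + g w)"
  by (rule square_integrable_bound[where k = "\<lambda>w. 2 * (norm (f w))\<^sup>2 + 2 * (norm (g w))\<^sup>2"])
    (use assms in \<open>auto simp: norm_add_squared_le square_integrable_def\<close>)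

lemma square_integrable_scaleR:
  assumes "square_integrable M f"
  shows "square_integrable M (\<lambda>w. a *\<^sub>R f w)"
  using assms by (auto simp: square_integrable_def power_mult_distrib)

text \<open>By Cauchy-Schwarz and the inequality
  \<open>2 * u * v \<le> u\<^sup>2 + v\<^sup>2\<close> for the two norms, the sum of the squared
  norms dominates.\<close>

lemma integrable_inner_square_integrable:
  assumes "square_integrable M f" and "square_integrable M g"
  shows "integrable M (\<lambda>w. f w \<bullet> g w)"
proof (rule Bochner_Integration.integrable_bound)
  show "integrable M (\<lambda>w. (norm (f w))\<^sup>2 + (norm (g w))\<^sup>2)"
    using assms by (auto simp: square_integrable_def)
  have "\<bar>f w \<bullet> g w\<bar> \<le> (norm (f w))\<^sup>2 + (norm (g w))\<^sup>2" for w
    using Cauchy_Schwarz_ineq2[of "f w" "g w"] sum_squares_bound[of "norm (f w)" "norm (g w)"]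
      zero_le_power2[of "norm (f w)"] zero_le_power2[of "norm (g w)"] by linarith
  then show "AE w in M. norm (f w \<bullet> g w) \<le> norm ((norm (f w))\<^sup>2 + (norm (g w))\<^sup>2)"
    by (auto intro!: order_trans[OF _ abs_ge_self])
qed (use assms in measurable)

lemma (in finite_measure) integrable_norm_square_integrable:
  assumes "square_integrable M f"
  shows "integrable M (\<lambda>w. norm (f w))"
proof (rule Bochner_Integration.integrable_bound)
  show "integrable M (\<lambda>w. (norm (f w))\<^sup>2 + 1)"
    using assms by (auto simp: square_integrable_def)
  have "norm (f w) \<le> (norm (f w))\<^sup>2 + 1" for w
  proof -
    have "2 * norm (f w) \<le> (norm (f w))\<^sup>2 + 1"
      using sum_squares_bound[of "norm (f w)" 1] by simp
    then show ?thesis using norm_ge_zero[of "f w"] by linarith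
  qed
  then show "AE w in M. norm (norm (f w)) \<le> norm ((norm (f w))\<^sup>2 + 1)"
    by (auto intro!: order_trans[OF _ abs_ge_self])
qed (use assms in measurable)

lemma (in finite_measure) square_integrable_const: "square_integrable M (\<lambda>w. a)"
  by (simp add: square_integrable_def)

text \<open>A Lipschitz map grows at most linearly, and constants are integrable under a finite
  measure.\<close>

lemma (in finite_measure) square_integrable_lipschitz:
  assumes f: "L-lipschitz_on UNIV f" and X: "square_integrable M X"
  shows "square_integrable M (\<lambda>w. f (X w))"
proof (rule square_integrable_bound)
  have "f \<in> borel_measurable borel"
    using f by (intro borel_measurable_continuous_onI lipschitz_on_continuous_on)
  then show "(\<lambda>w. f (X w)) \<in> borel_measurable M"
    using X by measurable
  show "integrable M (\<lambda>w. 2 * (norm (f 0))\<^sup>2 + 2 * (L\<^sup>2 * (norm (X w))\<^sup>2))"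
    using X by (auto simp: square_integrable_def)
  have "(norm (f x))\<^sup>2 \<le> 2 * (norm (f 0))\<^sup>2 + 2 * (L\<^sup>2 * (norm x)\<^sup>2)" for x
  proof -
    have "norm (f x - f 0) \<le> L * norm x"
      using lipschitz_onD[OF f, of x 0] by (simp add: dist_norm)
    then have "(norm (f x - f 0))\<^sup>2 \<le> L\<^sup>2 * (norm x)\<^sup>2"
      by (metis norm_ge_zero power_mono power_mult_distrib)
    then show ?thesis
      using norm_add_squared_le[of "f 0" "f x - f 0"] by simp
  qed
  then show "AE w in M. (norm (f (X w)))\<^sup>2 \<le> 2 * (norm (f 0))\<^sup>2 + 2 * (L\<^sup>2 * (norm (X w))\<^sup>2)"
    by simp
qed

text \<open>The quadratic bound around 0 controls \<open>f\<close> from above and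
  \<open>below\<close> controls it from below, so an integrable quadratic function of
  \<open>norm (X w)\<close> dominates.\<close>

lemma (in finite_measure) integrable_lipschitz_gradient:
  assumes diff: "\<And>x. f differentiable (at x)" and lip: "L-lipschitz_on UNIV (gradient f)"
    and below: "bdd_below (range f)" and X: "square_integrable M X"
  shows "integrable M (\<lambda>w. f (X w))"
proof -
  obtain m where m: "\<And>x. m \<le> f x"
    using below by (auto simp: bdd_below_def)
  let ?k = "\<lambda>x. \<bar>m\<bar> + \<bar>f 0\<bar> + norm (gradient f 0) * norm x + L / 2 * (norm x)\<^sup>2"
  have k: "\<bar>f x\<bar> \<le> ?k x" for x
  proof -
    have "f x \<le> f 0 + x \<bullet> gradient f 0 + L / 2 * (norm x)\<^sup>2"
      using lipschitz_gradient_upper_bound[OF diff lip, of 0 x] by simp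
    moreover have "x \<bullet> gradient f 0 \<le> norm (gradient f 0) * norm x"
      by (metis mult.commute norm_cauchy_schwarz)
    moreover have "0 \<le> norm (gradient f 0) * norm x" "0 \<le> L / 2 * (norm x)\<^sup>2"
      using lipschitz_on_nonneg[OF lip] by auto
    ultimately show ?thesis using m[of x] by linarith
  qed
  have "f \<in> borel_measurable borel"
    using diff by (intro borel_measurable_continuous_onI continuous_at_imp_continuous_on)
      (auto intro: differentiable_imp_continuous_within)
  then have meas: "(\<lambda>w. f (X w)) \<in> borel_measurable M"
    using X by measurable
  have int: "integrable M (\<lambda>w. ?k (X w))"
    using X integrable_norm_square_integrable[OF X] by (auto simp: square_integrable_def)
  have "AE w in M. norm (f (X w)) \<le> norm (?k (X w))"
    using k by (auto intro!: order_trans[OF _ abs_ge_self])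
  then show ?thesis
    by (rule Bochner_Integration.integrable_bound[OF int meas])
qed

section \<open>Conditional expectations of random vectors\<close>

lemma borel_measurable_vec_cond_exp [measurable]:
  "vec_cond_exp M F f \<in> borel_measurable F"
  unfolding vec_cond_exp_def by measurable

text \<open>The scalar pull-out rule, applied in each coordinate. Square integrability of
  \<open>f\<close> and \<open>g\<close> supplies the integrable products which that rule
  requires.\<close>

lemma (in sigma_finite_subalgebra) integral_inner_vec_cond_exp:
  assumes f: "square_integrable M f" and [measurable]: "f \<in> borel_measurable F"
    and g: "square_integrable M g"
  shows "(\<integral>w. f w \<bullet> vec_cond_exp M F g w \<partial>M) = (\<integral>w. f w \<bullet> g w \<partial>M)"
proof -
  have sq: "square_integrable M (\<lambda>w. k w \<bullet> b)"
    if "square_integrable M k" "b \<in> Basis" for k :: "'a \<Rightarrow> 'b" and b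
    by (rule square_integrable_bound[where k = "\<lambda>w. (norm (k w))\<^sup>2"])
      (use that in \<open>auto simp: square_integrable_def Basis_le_norm abs_le_square_iff[symmetric]\<close>)
  have int: "integrable M (\<lambda>w. (f w \<bullet> b) * (g w \<bullet> b))" if "b \<in> Basis" for b
    using integrable_inner_square_integrable[OF sq[OF f that] sq[OF g that]] by simp
  have [measurable]: "g \<in> borel_measurable M" using g by measurable
  have ce: "integrable M (\<lambda>w. (f w \<bullet> b) * real_cond_exp M F (\<lambda>w. g w \<bullet> b) w)"
    "(\<integral>w. (f w \<bullet> b) * real_cond_exp M F (\<lambda>w. g w \<bullet> b) w \<partial>M)
       = (\<integral>w. (f w \<bullet> b) * (g w \<bullet> b) \<partial>M)" if "b \<in> Basis" for b
    by (rule real_cond_exp_intg[OF int[OF that]]; measurable)+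
  have "(\<integral>w. f w \<bullet> vec_cond_exp M F g w \<partial>M)
      = (\<integral>w. (\<Sum>b\<in>Basis. (f w \<bullet> b) * real_cond_exp M F (\<lambda>w. g w \<bullet> b) w) \<partial>M)"
    by (simp add: vec_cond_exp_def inner_sum_right mult.commute)
  also have "\<dots> = (\<Sum>b\<in>Basis. \<integral>w. (f w \<bullet> b) * real_cond_exp M F (\<lambda>w. g w \<bullet> b) w \<partial>M)"
    by (rule Bochner_Integration.integral_sum) (rule ce)
  also have "\<dots> = (\<Sum>b\<in>Basis. \<integral>w. (f w \<bullet> b) * (g w \<bullet> b) \<partial>M)"
    by (intro sum.cong refl ce)
  also have "\<dots> = (\<integral>w. (\<Sum>b\<in>Basis. (f w \<bullet> b) * (g w \<bullet> b)) \<partial>M)"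
    by (rule Bochner_Integration.integral_sum[symmetric]) (rule int)
  finally show ?thesis by (simp only: euclidean_inner[symmetric])
qed

section \<open>Biased stochastic gradient descent\<close>

lemma (in prob_space) biased_sgd_step:
  fixes h :: "'b::euclidean_space \<Rightarrow> real"
  assumes diff: "\<And>x. h differentiable (at x)" and L_pos: "0 < L"
    and lip: "L-lipschitz_on UNIV (gradient h)" and below: "bdd_below (range h)"
    and sub: "subalgebra M F" and X_F: "X \<in> borel_measurable F" and X: "square_integrable M X"
    and g [measurable]: "g \<in> borel_measurable M"
    and bias: "AE w in M. norm (vec_cond_exp M F g w - gradient h (X w)) \<le> \<delta>"
    and variance: "AE w in M.
      nn_cond_exp M F (\<lambda>w. ennreal ((norm (g w - vec_cond_exp M F g w))\<^sup>2)) w \<le> ennreal (\<sigma>\<^sup>2)"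
    and a: "0 \<le> a" "a * L \<le> 1"
    and update: "\<And>w. w \<in> space M \<Longrightarrow> X' w = X w - a *\<^sub>R g w"
  shows "square_integrable M X'"
    and "expectation (\<lambda>w. h (X' w)) + a / 2 * expectation (\<lambda>w. (norm (gradient h (X w)))\<^sup>2)
      \<le> expectation (\<lambda>w. h (X w)) + (a / 2 * \<delta>\<^sup>2 + L * a\<^sup>2 / 2 * \<sigma>\<^sup>2)"
proof -
  interpret finite_measure_subalgebra M F
    by unfold_locales (rule sub)
  define D where "D = (\<lambda>w. gradient h (X w))"
  define B where "B = vec_cond_exp M F g"
  have "gradient h \<in> borel_measurable borel"
    using lip by (intro borel_measurable_continuous_onI lipschitz_on_continuous_on)
  then have D_F: "D \<in> borel_measurable F"
    unfolding D_def using X_F by measurable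
  have D: "square_integrable M D"
    unfolding D_def by (rule square_integrable_lipschitz[OF lip X])
  have B_F: "B \<in> borel_measurable F"
    unfolding B_def by measurable
  have [measurable]: "B \<in> borel_measurable M" "D \<in> borel_measurable M"
    using B_F D_F sub by (auto intro: measurable_from_subalg)
  have bias2: "AE w in M. (norm (B w - D w))\<^sup>2 \<le> \<delta>\<^sup>2"
    using bias unfolding B_def D_def by eventually_elim (simp add: power_mono)
  \<comment> \<open>\<open>B\<close> is reached through \<open>D\<close>, already known to be square
    integrable: their difference is bounded almost everywhere.\<close>
  then have BD: "square_integrable M (\<lambda>w. B w - D w)"
    by (intro square_integrable_bound[where k = "\<lambda>_. \<delta>\<^sup>2"]) auto
  have B: "square_integrable M B"
    using square_integrable_add[OF BD D] by simp
  \<comment> \<open>Integrating the conditional variance with weight 1 gives the total variance. The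
    nonnegative integral is used because square integrability of \<open>g - B\<close> is only a
    consequence of this bound.\<close>
  have "(\<integral>\<^sup>+w. ennreal ((norm (g w - B w))\<^sup>2) \<partial>M)
      = (\<integral>\<^sup>+w. nn_cond_exp M F (\<lambda>w. ennreal ((norm (g w - B w))\<^sup>2)) w \<partial>M)"
    using nn_cond_exp_intg[of "\<lambda>_. 1" "\<lambda>w. ennreal ((norm (g w - B w))\<^sup>2)"] by simp
  also have "\<dots> \<le> (\<integral>\<^sup>+w. ennreal (\<sigma>\<^sup>2) \<partial>M)"
    using variance unfolding B_def by (rule nn_integral_mono_AE)
  also have "\<dots> = ennreal (\<sigma>\<^sup>2)"
    by (simp add: emeasure_space_1)
  finally have var: "(\<integral>\<^sup>+w. ennreal ((norm (g w - B w))\<^sup>2) \<partial>M) \<le> ennreal (\<sigma>\<^sup>2)" .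
  have V: "square_integrable M (\<lambda>w. g w - B w)"
    unfolding square_integrable_def
  proof
    show "integrable M (\<lambda>w. (norm (g w - B w))\<^sup>2)"
      using var by (intro integrableI_bounded) (auto intro: le_less_trans)
  qed measurable
  have var: "expectation (\<lambda>w. (norm (g w - B w))\<^sup>2) \<le> \<sigma>\<^sup>2"
    using var nn_integral_eq_integral[of M "\<lambda>w. (norm (g w - B w))\<^sup>2"] V
    by (simp add: square_integrable_def)
  have g2: "square_integrable M g"
    using square_integrable_add[OF V B] by simp
  have "square_integrable M (\<lambda>w. X w + (- a) *\<^sub>R g w)"
    by (intro square_integrable_add square_integrable_scaleR X g2)
  moreover have "square_integrable M X' \<longleftrightarrow> square_integrable M (\<lambda>w. X w + (- a) *\<^sub>R g w)"
    by (rule square_integrable_cong) (simp add: update)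
  ultimately show X': "square_integrable M X'" by simp
  note inner_integrable = integrable_inner_square_integrable
  note sq_norm = square_integrable_def
  \<comment> \<open>\<open>D\<close> and \<open>B\<close> are both \<open>F\<close>-measurable, so
    in expected inner products with either of them \<open>g\<close> may be exchanged for its
    conditional mean \<open>B\<close>.\<close>
  have Dg: "expectation (\<lambda>w. D w \<bullet> B w) = expectation (\<lambda>w. D w \<bullet> g w)"
    unfolding B_def by (rule integral_inner_vec_cond_exp[OF D D_F g2])
  have Bg: "expectation (\<lambda>w. B w \<bullet> B w) = expectation (\<lambda>w. B w \<bullet> g w)"
    using integral_inner_vec_cond_exp[OF B B_F g2] unfolding B_def .
  \<comment> \<open>Decomposition of the second moment into variance and squared mean: by
    \<open>Bg\<close> the mixed term has twice the expectation of \<open>B w \<bullet> B w\<close>,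
    which leaves one copy after the subtraction.\<close>
  have "expectation (\<lambda>w. (norm (g w))\<^sup>2)
      = expectation (\<lambda>w. (norm (g w - B w))\<^sup>2 + (2 * (B w \<bullet> g w) - B w \<bullet> B w))"
    by (intro Bochner_Integration.integral_cong refl)
      (simp add: power2_norm_eq_inner inner_diff_left inner_diff_right inner_commute)
  also have "\<dots> = expectation (\<lambda>w. (norm (g w - B w))\<^sup>2) + expectation (\<lambda>w. B w \<bullet> B w)"
    using V inner_integrable[OF B g2] inner_integrable[OF B B] by (simp add: sq_norm Bg)
  finally have g_norm: "expectation (\<lambda>w. (norm (g w))\<^sup>2)
      \<le> \<sigma>\<^sup>2 + expectation (\<lambda>w. B w \<bullet> B w)"
    using var by simp
  \<comment> \<open>The cross term is kept exactly, as it will absorb the first-order decrease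
    \<open>- a * (D w \<bullet> B w)\<close>.\<close>
  have "expectation (\<lambda>w. (norm (B w - D w))\<^sup>2)
      = expectation (\<lambda>w. B w \<bullet> B w - 2 * (D w \<bullet> B w) + (norm (D w))\<^sup>2)"
    by (intro Bochner_Integration.integral_cong refl)
      (simp add: power2_norm_eq_inner inner_diff_left inner_diff_right inner_commute)
  also have "\<dots> = expectation (\<lambda>w. B w \<bullet> B w) - 2 * expectation (\<lambda>w. D w \<bullet> B w)
      + expectation (\<lambda>w. (norm (D w))\<^sup>2)"
    using D inner_integrable[OF D B] inner_integrable[OF B B] by (simp add: sq_norm)
  moreover have "expectation (\<lambda>w. (norm (B w - D w))\<^sup>2) \<le> expectation (\<lambda>w. \<delta>\<^sup>2)"
    using BD bias2 by (intro integral_mono_AE) (auto simp: sq_norm)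
  ultimately have BD_norm: "expectation (\<lambda>w. B w \<bullet> B w) - 2 * expectation (\<lambda>w. D w \<bullet> B w)
      + expectation (\<lambda>w. (norm (D w))\<^sup>2) \<le> \<delta>\<^sup>2"
    by (simp add: prob_space)
  note h_int = integrable_lipschitz_gradient[OF diff lip below]
  have "h (X' w) \<le> h (X w) - a * (D w \<bullet> g w) + L * a\<^sup>2 / 2 * (norm (g w))\<^sup>2"
    if "w \<in> space M" for w
    using lipschitz_gradient_upper_bound[OF diff lip, of "X w" "- a *\<^sub>R g w"] update[OF that]
    by (simp add: D_def power_mult_distrib inner_commute mult.assoc)
  then have "expectation (\<lambda>w. h (X' w))
      \<le> expectation (\<lambda>w. h (X w) - a * (D w \<bullet> g w) + L * a\<^sup>2 / 2 * (norm (g w))\<^sup>2)"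
    using h_int[OF X] h_int[OF X'] inner_integrable[OF D g2] g2
    by (intro integral_mono) (auto simp: sq_norm)
  also have "\<dots> = expectation (\<lambda>w. h (X w)) - a * expectation (\<lambda>w. D w \<bullet> g w)
      + L * a\<^sup>2 / 2 * expectation (\<lambda>w. (norm (g w))\<^sup>2)"
    using h_int[OF X] inner_integrable[OF D g2] g2 by (simp add: sq_norm)
  also have "\<dots> \<le> expectation (\<lambda>w. h (X w)) - a * expectation (\<lambda>w. D w \<bullet> B w)
      + L * a\<^sup>2 / 2 * (\<sigma>\<^sup>2 + expectation (\<lambda>w. B w \<bullet> B w))"
    using g_norm L_pos by (simp add: Dg mult_left_mono)
  also have "\<dots> \<le> expectation (\<lambda>w. h (X w)) - a * expectation (\<lambda>w. D w \<bullet> B w)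
      + L * a\<^sup>2 / 2 * \<sigma>\<^sup>2 + a / 2 * expectation (\<lambda>w. B w \<bullet> B w)"
  proof -
    \<comment> \<open>The restriction \<open>a * L \<le> 1\<close> on the step size raises the
      coefficient of the second moment of \<open>B\<close> to \<open>a / 2\<close>, the value that
      completes the square with \<open>- a * (D w \<bullet> B w)\<close>.\<close>
    have "L * a\<^sup>2 / 2 \<le> a / 2"
      using mult_left_mono[OF a(2) a(1)] by (simp add: power2_eq_square mult_ac)
    moreover have "0 \<le> expectation (\<lambda>w. B w \<bullet> B w)" by simp
    ultimately have "L * a\<^sup>2 / 2 * expectation (\<lambda>w. B w \<bullet> B w)
        \<le> a / 2 * expectation (\<lambda>w. B w \<bullet> B w)"
      by (rule mult_right_mono)
    then show ?thesis by (simp add: distrib_left)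
  qed
  finally have "expectation (\<lambda>w. h (X' w)) \<le> expectation (\<lambda>w. h (X w)) + L * a\<^sup>2 / 2 * \<sigma>\<^sup>2
      + a / 2 * (expectation (\<lambda>w. B w \<bullet> B w) - 2 * expectation (\<lambda>w. D w \<bullet> B w))"
    by (simp add: algebra_simps)
  \<comment> \<open>Completing the square: the bias bound pays for \<open>B - D\<close>, and the
    squared norm of \<open>D\<close> can move to the left-hand side.\<close>
  moreover have "a / 2 * (expectation (\<lambda>w. B w \<bullet> B w) - 2 * expectation (\<lambda>w. D w \<bullet> B w)
      + expectation (\<lambda>w. (norm (D w))\<^sup>2)) \<le> a / 2 * \<delta>\<^sup>2"
    using BD_norm a(1) by (intro mult_left_mono) auto
  ultimately have "expectation (\<lambda>w. h (X' w)) + a / 2 * expectation (\<lambda>w. (norm (D w))\<^sup>2)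
      \<le> expectation (\<lambda>w. h (X w)) + (a / 2 * \<delta>\<^sup>2 + L * a\<^sup>2 / 2 * \<sigma>\<^sup>2)"
    unfolding distrib_left by linarith
  then show "expectation (\<lambda>w. h (X' w))
      + a / 2 * expectation (\<lambda>w. (norm (gradient h (X w)))\<^sup>2)
      \<le> expectation (\<lambda>w. h (X w)) + (a / 2 * \<delta>\<^sup>2 + L * a\<^sup>2 / 2 * \<sigma>\<^sup>2)"
    by (simp only: D_def)
qed

text \<open>Only unconditional expectations pass from one step to the next, so the
  \<open>F t\<close> may be unrelated to each other; the algebras generated by
  \<open>(\<pi> t, \<theta> t)\<close> need not form a filtration.\<close>

lemma (in prob_space) biased_sgd:
  fixes h :: "'b::euclidean_space \<Rightarrow> real"
  assumes diff: "\<And>x. h differentiable (at x)" and L_pos: "0 < L"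
    and lip: "L-lipschitz_on UNIV (gradient h)" and below: "bdd_below (range h)"
    and sub: "\<And>t. t < T \<Longrightarrow> subalgebra M (F t)"
    and X_F: "\<And>t. t < T \<Longrightarrow> X t \<in> borel_measurable (F t)"
    and g: "\<And>t. t < T \<Longrightarrow> g t \<in> borel_measurable M"
    and bias: "\<And>t. t < T \<Longrightarrow>
      AE w in M. norm (vec_cond_exp M (F t) (g t) w - gradient h (X t w)) \<le> \<delta>"
    and variance: "\<And>t. t < T \<Longrightarrow> AE w in M.
      nn_cond_exp M (F t) (\<lambda>w. ennreal ((norm (g t w - vec_cond_exp M (F t) (g t) w))\<^sup>2)) w
        \<le> ennreal (\<sigma>\<^sup>2)"
    and a: "0 \<le> a" "a * L \<le> 1"
    and initial: "\<And>w. w \<in> space M \<Longrightarrow> X 0 w = x0"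
    and update: "\<And>t w. t < T \<Longrightarrow> w \<in> space M \<Longrightarrow> X (Suc t) w = X t w - a *\<^sub>R g t w"
  shows "\<And>t. t < T \<Longrightarrow> integrable M (\<lambda>w. (norm (gradient h (X t w)))\<^sup>2)"
    and "a / 2 * (\<Sum>t<T. expectation (\<lambda>w. (norm (gradient h (X t w)))\<^sup>2))
      \<le> h x0 - (INF x. h x) + real T * (a / 2 * \<delta>\<^sup>2 + L * a\<^sup>2 / 2 * \<sigma>\<^sup>2)"
proof -
  let ?E = "\<lambda>t. expectation (\<lambda>w. (norm (gradient h (X t w)))\<^sup>2)"
  let ?e = "a / 2 * \<delta>\<^sup>2 + L * a\<^sup>2 / 2 * \<sigma>\<^sup>2"
  \<comment> \<open>Both claims go through one induction, because the inequality for the next step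
    presupposes that \<open>X n\<close> is square integrable.\<close>
  have iterates: "square_integrable M (X n) \<and>
      expectation (\<lambda>w. h (X n w)) + a / 2 * (\<Sum>t<n. ?E t) \<le> h x0 + real n * ?e"
    if "n \<le> T" for n
    using that
  proof (induction n)
    case 0
    have "square_integrable M (X 0) \<longleftrightarrow> square_integrable M (\<lambda>w. x0)"
      by (rule square_integrable_cong) (simp add: initial)
    moreover have "expectation (\<lambda>w. h (X 0 w)) = expectation (\<lambda>w. h x0)"
      using initial by (intro Bochner_Integration.integral_cong) auto
    ultimately show ?case
      by (simp add: square_integrable_const prob_space)
  next
    case (Suc n)
    then have n: "n < T" and IH: "square_integrable M (X n)"
      "expectation (\<lambda>w. h (X n w)) + a / 2 * (\<Sum>t<n. ?E t) \<le> h x0 + real n * ?e"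
      by auto
    note step = biased_sgd_step[OF diff L_pos lip below sub[OF n] X_F[OF n] IH(1) g[OF n]
        bias[OF n] variance[OF n] a update[OF n]]
    have "expectation (\<lambda>w. h (X (Suc n) w)) + a / 2 * (\<Sum>t<Suc n. ?E t)
        = (expectation (\<lambda>w. h (X (Suc n) w)) + a / 2 * ?E n) + a / 2 * (\<Sum>t<n. ?E t)"
      by (simp add: distrib_left)
    also have "\<dots> \<le> (expectation (\<lambda>w. h (X n w)) + ?e) + a / 2 * (\<Sum>t<n. ?E t)"
      by (intro add_right_mono step(2))
    also have "\<dots> \<le> (h x0 + real n * ?e) + ?e"
      using add_right_mono[OF IH(2), of ?e] by (simp only: ac_simps)
    also have "\<dots> = h x0 + real (Suc n) * ?e"
      by (simp only: of_nat_Suc distrib_right mult_1_left ac_simps)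
    finally show ?case using step(1) by blast
  qed
  show "integrable M (\<lambda>w. (norm (gradient h (X t w)))\<^sup>2)" if "t < T" for t
    using square_integrable_lipschitz[OF lip] iterates[of t] that
    by (auto simp: square_integrable_def)
  have XT: "square_integrable M (X T)"
    using iterates by simp
  \<comment> \<open>The telescoped sum leaves \<open>h\<close> at the iterate \<open>X T\<close>
    after the last update, which is why the induction reaches \<open>n = T\<close>; the infimum
    bounds it pointwise.\<close>
  have "(INF x. h x) = expectation (\<lambda>w. INF x. h x)"
    by (simp add: prob_space)
  also have "\<dots> \<le> expectation (\<lambda>w. h (X T w))"
    using integrable_lipschitz_gradient[OF diff lip below XT] below
    by (intro integral_mono) (auto intro: cINF_lower)
  finally show "a / 2 * (\<Sum>t<T. ?E t) \<le> h x0 - (INF x. h x) + real T * ?e"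
    using iterates[of T] by simp
qed

section \<open>Measurability of the stochastic gradients\<close>

text \<open>Each coordinate is a pointwise limit of difference quotients. Joint measurability of
  \<open>f\<close> makes every quotient measurable although its base point \<open>X w\<close> is
  random.\<close>

lemma borel_measurable_gradient:
  fixes f :: "'b::euclidean_space \<Rightarrow> 'a \<Rightarrow> real"
  assumes f: "(\<lambda>(x, w). f x w) \<in> borel_measurable (borel \<Otimes>\<^sub>M M)"
    and X [measurable]: "X \<in> borel_measurable M"
    and diff: "\<And>w x. w \<in> space M \<Longrightarrow> (\<lambda>x. f x w) differentiable (at x)"
  shows "(\<lambda>w. gradient (\<lambda>x. f x w) (X w)) \<in> borel_measurable M"
proof (rule borel_measurable_euclidean_space[THEN iffD2], rule ballI)
  fix b :: 'b assume "b \<in> Basis"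
  have f_Z: "(\<lambda>w. f (Z w) w) \<in> borel_measurable M" if "Z \<in> borel_measurable M" for Z
  proof -
    have "(\<lambda>w. (Z w, w)) \<in> M \<rightarrow>\<^sub>M borel \<Otimes>\<^sub>M M"
      by (rule measurable_Pair[OF that measurable_ident_sets[OF refl]])
    from measurable_compose[OF this f] show ?thesis
      by (simp only: prod.case)
  qed
  show "(\<lambda>w. gradient (\<lambda>x. f x w) (X w) \<bullet> b) \<in> borel_measurable M"
  proof (rule borel_measurable_LIMSEQ_real)
    show "(\<lambda>n. (f (X w + (1 / real (Suc n)) *\<^sub>R b) w - f (X w) w) * real (Suc n))
        \<longlonglongrightarrow> gradient (\<lambda>x. f x w) (X w) \<bullet> b" if "w \<in> space M" for w
      by (rule gradient_difference_quotient[OF diff[OF that]])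
    show "(\<lambda>w. (f (X w + (1 / real (Suc n)) *\<^sub>R b) w - f (X w) w) * real (Suc n))
        \<in> borel_measurable M" for n
      by (intro borel_measurable_times borel_measurable_diff borel_measurable_const f_Z) measurable
  qed
qed

context ot_sgd
begin

lemma borel_measurable_cost:
  assumes "A \<in> borel_measurable M" "B \<in> M \<rightarrow>\<^sub>M \<mu>" "C \<in> M \<rightarrow>\<^sub>M \<nu>"
  shows "(\<lambda>w. c (G (A w) (B w)) (C w)) \<in> borel_measurable M"
proof -
  \<comment> \<open>The sigma-algebra of \<open>\<nu>\<close> is the trace of the Borel sets on
    \<open>Y\<close>, so a measurable map into \<open>\<nu>\<close> is also Borel measurable into
    the ambient space, where \<open>c\<close> is defined.\<close>
  have [measurable]: "C \<in> borel_measurable M"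
    using assms(3) measurable_cong_sets[OF refl sets_y, of M]
    by (auto simp: measurable_restrict_space2_iff)
  have [measurable]: "(\<lambda>w. G (A w) (B w)) \<in> borel_measurable M"
    using measurable_compose[OF _ measurable_G, of "\<lambda>w. (A w, B w)" M] assms by simp
  show ?thesis
    using measurable_compose[OF _ measurable_c, of "\<lambda>w. (G (A w) (B w), C w)" M] by simp
qed

lemma borel_measurable_reg_M: "reg_M r lam \<in> borel_measurable borel"
  unfolding reg_M_def[abs_def] by (cases r) simp_all

text \<open>Joint measurability of \<open>\<phi> t\<close> and \<open>\<psi> t\<close> permits
  evaluating these random functions at random points. The points are the samples in the proof for
  \<open>g t\<close>, and constants in the proof for the algebra generated by
  \<open>(\<pi> t, \<theta> t)\<close>.\<close>

lemma borel_measurable_plan: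
  assumes t: "t < T" and id: "(\<lambda>w. w) \<in> M \<rightarrow>\<^sub>M hist t" and M: "space M = space P"
    and [measurable]: "A \<in> M \<rightarrow>\<^sub>M \<mu>" "C \<in> M \<rightarrow>\<^sub>M \<nu>"
  shows "(\<lambda>w. \<pi> t w (A w, C w)) \<in> borel_measurable M"
proof -
  have [measurable]: "q \<in> borel_measurable \<mu>" "p \<in> borel_measurable \<nu>"
    using density_q density_p by (auto simp: is_density_def)
  have "(\<lambda>w. \<theta> t w) \<in> borel_measurable M"
    using measurable_compose[OF id hist_param[OF t]] .
  then have [measurable]: "(\<lambda>w. c (G (\<theta> t w) (A w)) (C w)) \<in> borel_measurable M"
    by (rule borel_measurable_cost) fact+
  have [measurable]: "(\<lambda>w. \<phi> t w (A w)) \<in> borel_measurable M"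
    using measurable_compose[OF _ hist_phi[OF t], of "\<lambda>w. (w, A w)" M] id by simp
  have [measurable]: "(\<lambda>w. \<psi> t w (C w)) \<in> borel_measurable M"
    using measurable_compose[OF _ hist_psi[OF t], of "\<lambda>w. (w, C w)" M] id by simp
  have "(\<lambda>w. q (A w) * p (C w) * reg_M r lam (\<phi> t w (A w) - \<psi> t w (C w) - c (G (\<theta> t w) (A w)) (C w)))
      \<in> borel_measurable M"
    using borel_measurable_reg_M by measurable
  then show ?thesis
    by (rule measurable_cong[THEN iffD2, rotated]) (simp add: plan[OF t] M plan_of_duals_def)
qed

lemma measurable_hist: "t < T \<Longrightarrow> (\<lambda>w. w) \<in> P \<rightarrow>\<^sub>M hist t"
  by (rule measurable_from_subalg[OF hist_sub measurable_ident_sets[OF refl]])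

lemma measurable_samples:
  assumes "t < T" "i \<in> {1..S}"
  shows "xs t i \<in> P \<rightarrow>\<^sub>M \<mu>" "ys t i \<in> P \<rightarrow>\<^sub>M \<nu>"
  using samples_x[OF assms] samples_y[OF assms] by (auto simp: distributed_def)

lemma borel_measurable_stochastic_gradient:
  assumes t: "t < T"
  shows "g t \<in> borel_measurable P"
proof -
  have [measurable]: "q \<in> borel_measurable \<mu>" "p \<in> borel_measurable \<nu>"
    using density_q density_p by (auto simp: is_density_def)
  have param: "\<theta> t \<in> borel_measurable P"
    using measurable_compose[OF measurable_hist[OF t] hist_param[OF t]] .
  have summand: "(\<lambda>w. (\<pi> t w (xs t i w, ys t j w) / (q (xs t i w) * p (ys t j w))) *\<^sub>R
      gradient (\<lambda>\<zeta>. c (G \<zeta> (xs t i w)) (ys t j w)) (\<theta> t w)) \<in> borel_measurable P"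
    if "i \<in> {1..S}" "j \<in> {1..S}" for i j
  proof -
    have [measurable]: "xs t i \<in> P \<rightarrow>\<^sub>M \<mu>" "ys t j \<in> P \<rightarrow>\<^sub>M \<nu>"
      using measurable_samples[OF t] that by auto
    have "(\<lambda>w. gradient (\<lambda>\<zeta>. c (G \<zeta> (xs t i w)) (ys t j w)) (\<theta> t w)) \<in> borel_measurable P"
    proof (rule borel_measurable_gradient[OF _ param])
      show "(\<lambda>(\<zeta>, w). c (G \<zeta> (xs t i w)) (ys t j w)) \<in> borel_measurable (borel \<Otimes>\<^sub>M P)"
        using borel_measurable_cost[of fst "borel \<Otimes>\<^sub>M P" "\<lambda>z. xs t i (snd z)" "\<lambda>z. ys t j (snd z)"]
        by (simp add: case_prod_beta')
      fix w \<eta> assume w: "w \<in> space P"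
      then have "xs t i w \<in> space \<mu>" "ys t j w \<in> Y"
        using measurable_samples[OF t] that space_y by (auto dest: measurable_space)
      then show "(\<lambda>\<zeta>. c (G \<zeta> (xs t i w)) (ys t j w)) differentiable (at \<eta>)"
        by (rule differentiable_cost)
    qed
    moreover have "(\<lambda>w. \<pi> t w (xs t i w, ys t j w)) \<in> borel_measurable P"
      by (rule borel_measurable_plan[OF t measurable_hist[OF t]]) simp_all
    ultimately show ?thesis by measurable
  qed
  have "(\<lambda>w. stoch_grad q p G c S (\<pi> t w) (\<theta> t w) (\<lambda>i. xs t i w) (\<lambda>j. ys t j w))
      \<in> borel_measurable P"
    unfolding stoch_grad_def
    by (intro borel_measurable_scaleR borel_measurable_const borel_measurable_sum summand)
  then show ?thesis
    by (rule measurable_cong[THEN iffD2, rotated]) (rule stochastic_gradient[OF t])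
qed

text \<open>The product sigma-algebra on functions is generated by evaluations, so measurability of
  the random function \<open>\<pi> t\<close> reduces to that of \<open>\<pi> t w z\<close> for fixed
  \<open>z\<close>. The parameter \<open>\<theta> t\<close> is the second component of the
  generating map.\<close>

lemma plan_param_algebra:
  assumes t: "t < T"
  shows "subalgebra P (plan_param_algebra P \<mu> \<nu> (\<pi> t) (\<theta> t))" (is "subalgebra P ?F")
    and "\<theta> t \<in> borel_measurable (plan_param_algebra P \<mu> \<nu> (\<pi> t) (\<theta> t))"
proof -
  let ?N = "(\<Pi>\<^sub>M z\<in>space \<mu> \<times> space \<nu>. borel) \<Otimes>\<^sub>M (borel :: 'b measure)"
  let ?f = "\<lambda>w. (restrict (\<pi> t w) (space \<mu> \<times> space \<nu>), \<theta> t w)"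
  have param: "\<theta> t \<in> borel_measurable P"
    using measurable_compose[OF measurable_hist[OF t] hist_param[OF t]] .
  have "(\<lambda>w. restrict (\<pi> t w) (space \<mu> \<times> space \<nu>)) \<in> P \<rightarrow>\<^sub>M (\<Pi>\<^sub>M z\<in>space \<mu> \<times> space \<nu>. borel)"
  proof (rule measurable_restrict)
    fix z assume "z \<in> space \<mu> \<times> space \<nu>"
    then show "(\<lambda>w. \<pi> t w z) \<in> borel_measurable P"
      using borel_measurable_plan[OF t measurable_hist[OF t], of "\<lambda>_. fst z" "\<lambda>_. snd z"] by auto
  qed
  with param have f: "?f \<in> P \<rightarrow>\<^sub>M ?N" by simp
  then have "?f \<in> space P \<rightarrow> space ?N"
    by (auto dest: measurable_space)
  then have "?f \<in> ?F \<rightarrow>\<^sub>M ?N"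
    unfolding plan_param_algebra_def by (rule measurable_vimage_algebra1)
  from measurable_compose[OF this measurable_snd] show "\<theta> t \<in> borel_measurable ?F"
    by simp
  \<comment> \<open>As the two spaces agree, measurability of the identity amounts to inclusion of
    the sigma-algebras.\<close>
  have id: "(\<lambda>w. w) \<in> P \<rightarrow>\<^sub>M ?F"
    unfolding plan_param_algebra_def by (rule measurable_vimage_algebra2) (use f in auto)
  have space: "space ?F = space P"
    by (simp add: plan_param_algebra_def)
  have "A \<in> sets P" if "A \<in> sets ?F" for A
    using measurable_sets[OF id that] sets.sets_into_space[OF that] by (simp add: space Int_absorb2)
  with space show "subalgebra P ?F"
    unfolding subalgebra_def by blast
qed

end

section \<open>Convergence of the procedure\<close>

theorem theorem4p2:
  fixes r :: regularizer and lam :: real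
    and \<mu> :: "'x measure" and q :: "'x \<Rightarrow> real"
    and Y :: "(real ^ 'd) set" and \<nu> :: "(real ^ 'd) measure" and p :: "real ^ 'd \<Rightarrow> real"
    and G :: "'b::euclidean_space \<Rightarrow> 'x \<Rightarrow> real ^ 'd"
    and c :: "real ^ 'd \<Rightarrow> real ^ 'd \<Rightarrow> real"
    and P :: "'w measure" and hist :: "nat \<Rightarrow> 'w measure"
    and T S :: nat and \<alpha> :: "nat \<Rightarrow> real" and \<epsilon> :: real and \<theta>0 :: 'b
    and \<phi> :: "nat \<Rightarrow> 'w \<Rightarrow> 'x \<Rightarrow> real" and \<psi> :: "nat \<Rightarrow> 'w \<Rightarrow> real ^ 'd \<Rightarrow> real"
    and \<pi> :: "nat \<Rightarrow> 'w \<Rightarrow> 'x \<times> (real ^ 'd) \<Rightarrow> real"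
    and xs :: "nat \<Rightarrow> nat \<Rightarrow> 'w \<Rightarrow> 'x" and ys :: "nat \<Rightarrow> nat \<Rightarrow> 'w \<Rightarrow> real ^ 'd"
    and g \<theta> Gbar :: "nat \<Rightarrow> 'w \<Rightarrow> 'b"
    and F :: "nat \<Rightarrow> 'w measure"
    and h :: "'b \<Rightarrow> real" and L \<Delta> \<delta> \<sigma> :: real
  assumes procedure: "ot_sgd r lam \<mu> q Y \<nu> p G c P hist T S \<alpha> \<epsilon> \<theta>0 \<phi> \<psi> \<pi> xs ys g \<theta>"
    and h_eq: "h = (\<lambda>\<eta>. ot_value r lam \<mu> q \<nu> p (G \<eta>) c)"
    and h_differentiable: "\<forall>\<eta>. h differentiable (at \<eta>)"
    and L_pos: "0 < L"
    and h_smooth: "L-lipschitz_on UNIV (gradient h)"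
    and h_bounded_below: "bdd_below (range h)"
    and \<Delta>_eq: "\<Delta> = h \<theta>0 - (INF \<eta>. h \<eta>)"
    and F_eq: "F = (\<lambda>t. plan_param_algebra P \<mu> \<nu> (\<pi> t) (\<theta> t))"
    and Gbar_eq: "Gbar = (\<lambda>t. vec_cond_exp P (F t) (g t))"
    and bias: "\<forall>t<T. AE w in P. norm (Gbar t w - gradient h (\<theta> t w)) \<le> \<delta>"
    and \<sigma>_pos: "0 < \<sigma>"
    and variance: "\<forall>t<T. AE w in P.
      nn_cond_exp P (F t) (\<lambda>w. ennreal ((norm (g t w - Gbar t w))\<^sup>2)) w \<le> ennreal (\<sigma>\<^sup>2)"
  shows "(real T < 2 * \<Delta> * L / \<sigma>\<^sup>2 \<and> (\<forall>t<T. \<alpha> t = 1 / L) \<longrightarrow>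
      (\<forall>t<T. integrable P (\<lambda>w. (norm (gradient h (\<theta> t w)))\<^sup>2)) \<and>
      1 / real T * (\<Sum>t<T. \<integral>w. (norm (gradient h (\<theta> t w)))\<^sup>2 \<partial>P)
        \<le> 2 * L * \<Delta> / real T + \<delta>\<^sup>2 + \<sigma>\<^sup>2)
    \<and> (real T \<ge> 2 * \<Delta> * L / \<sigma>\<^sup>2 \<and> (\<forall>t<T. \<alpha> t = sqrt (2 * \<Delta> / (L * \<sigma>\<^sup>2 * real T))) \<longrightarrow>
      (\<forall>t<T. integrable P (\<lambda>w. (norm (gradient h (\<theta> t w)))\<^sup>2)) \<and>
      1 / real T * (\<Sum>t<T. \<integral>w. (norm (gradient h (\<theta> t w)))\<^sup>2 \<partial>P)
        \<le> \<sigma> * sqrt (8 * L * \<Delta> / real T) + \<delta>\<^sup>2)"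
proof -
  interpret ot_sgd r lam \<mu> q Y \<nu> p G c P hist T S \<alpha> \<epsilon> \<theta>0 \<phi> \<psi> \<pi> xs ys g \<theta>
    by (rule procedure)
  let ?E = "\<lambda>t. \<integral>w. (norm (gradient h (\<theta> t w)))\<^sup>2 \<partial>P"
  let ?I = "\<forall>t<T. integrable P (\<lambda>w. (norm (gradient h (\<theta> t w)))\<^sup>2)"
  have T: "0 < real T" using iterations_pos by simp
  have \<Delta>: "0 \<le> \<Delta>"
    unfolding \<Delta>_eq using h_bounded_below by (simp add: cINF_lower)
  \<comment> \<open>The step size 0 is included, since integrability is claimed for
    \<open>\<Delta> = 0\<close> too, where the prescribed step size vanishes.\<close>
  have sgd: "?I \<and> a / 2 * (\<Sum>t<T. ?E t) \<le> \<Delta> + real T * (a / 2 * \<delta>\<^sup>2 + L * a\<^sup>2 / 2 * \<sigma>\<^sup>2)"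
    if "0 \<le> a" "a * L \<le> 1" "\<forall>t<T. \<alpha> t = a" for a
    using biased_sgd[of h L T F \<theta> g \<delta> \<sigma> a \<theta>0] that h_differentiable L_pos h_smooth
      h_bounded_below plan_param_algebra borel_measurable_stochastic_gradient bias variance
      initial update
    unfolding F_eq Gbar_eq \<Delta>_eq by simp
  have mean: "1 / real T * (\<Sum>t<T. ?E t) \<le> 2 * \<Delta> / (a * real T) + \<delta>\<^sup>2 + L * a * \<sigma>\<^sup>2"
    if "0 < a" "a * L \<le> 1" "\<forall>t<T. \<alpha> t = a" for a
  proof -
    have "a / 2 * (\<Sum>t<T. ?E t) \<le> \<Delta> + real T * (a / 2 * \<delta>\<^sup>2 + L * a\<^sup>2 / 2 * \<sigma>\<^sup>2)"
      using sgd[of a] that by simp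
    \<comment> \<open>The normalizing factor turns the left side into the mean; it is here that
      \<open>a\<close> has to be positive.\<close>
    then have "2 / (a * real T) * (a / 2 * (\<Sum>t<T. ?E t))
        \<le> 2 / (a * real T) * (\<Delta> + real T * (a / 2 * \<delta>\<^sup>2 + L * a\<^sup>2 / 2 * \<sigma>\<^sup>2))"
      using that T by (intro mult_left_mono) auto
    moreover have "2 / (a * real T) * (a / 2 * (\<Sum>t<T. ?E t)) = 1 / real T * (\<Sum>t<T. ?E t)"
      using that T by simp
    moreover have "2 / (a * real T) * (\<Delta> + real T * (a / 2 * \<delta>\<^sup>2 + L * a\<^sup>2 / 2 * \<sigma>\<^sup>2))
        = 2 * \<Delta> / (a * real T) + \<delta>\<^sup>2 + L * a * \<sigma>\<^sup>2"
      using that T by (simp add: field_simps power2_eq_square)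
    ultimately show ?thesis by (simp only:)
  qed
  show ?thesis
  proof (intro conjI impI; (elim conjE)?)
    assume \<alpha>: "\<forall>t<T. \<alpha> t = 1 / L"
    show ?I using sgd[OF _ _ \<alpha>] L_pos by simp
    show "1 / real T * (\<Sum>t<T. ?E t) \<le> 2 * L * \<Delta> / real T + \<delta>\<^sup>2 + \<sigma>\<^sup>2"
      using mean[OF _ _ \<alpha>] L_pos by (simp add: mult_ac)
  next
    let ?a = "sqrt (2 * \<Delta> / (L * \<sigma>\<^sup>2 * real T))"
    assume large: "2 * \<Delta> * L / \<sigma>\<^sup>2 \<le> real T" and \<alpha>: "\<forall>t<T. \<alpha> t = ?a"
    have nonneg: "0 \<le> ?a" using \<Delta> L_pos T by simp
    \<comment> \<open>Since \<open>?a\<^sup>2 * L\<^sup>2\<close> equals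
      \<open>2 * \<Delta> * L / (\<sigma>\<^sup>2 * real T)\<close>, the lower bound on
      \<open>T\<close> is what keeps the step size at most \<open>1 / L\<close>.\<close>
    have "2 * \<Delta> * L \<le> \<sigma>\<^sup>2 * real T"
      using large \<sigma>_pos by (simp add: field_simps)
    then have "?a\<^sup>2 * L\<^sup>2 \<le> 1"
      using \<Delta> L_pos T \<sigma>_pos by (simp add: field_simps power2_eq_square)
    then have small: "?a * L \<le> 1"
      using power2_le_imp_le[of "?a * L" 1] by (simp add: power_mult_distrib)
    show ?I using sgd[OF nonneg small \<alpha>] by simp
    show "1 / real T * (\<Sum>t<T. ?E t) \<le> \<sigma> * sqrt (8 * L * \<Delta> / real T) + \<delta>\<^sup>2"
    proof (cases "\<Delta> = 0")
      \<comment> \<open>The step size is then 0: the iterates stay at the minimizer \<open>\<theta>0\<close>.\<close>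
      case True
      have "h \<theta>0 \<le> h \<eta>" for \<eta>
        using True h_bounded_below cINF_lower[of h UNIV \<eta>] by (simp add: \<Delta>_eq)
      then have stationary: "gradient h \<theta>0 = 0"
        using h_differentiable by (intro gradient_eq_0_of_minimum) auto
      have stay: "\<theta> t w = \<theta>0" if "t \<le> T" "w \<in> space P" for t w
        using that
      proof (induction t)
        case (Suc t)
        then show ?case using update[of t w] \<alpha> True by simp
      qed (simp add: initial)
      have "?E t = 0" if "t < T" for t
      proof -
        have "?E t = (\<integral>w. 0 \<partial>P)"
          using stay that stationary by (intro Bochner_Integration.integral_cong) auto
        then show ?thesis by simp
      qed
      then show ?thesis using True by simp
    next
      case False
      then have pos: "0 < ?a" using \<Delta> L_pos T \<sigma>_pos by simp
      \<comment> \<open>The step size \<open>?a\<close> minimizes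
        \<open>2 * \<Delta> / (a * real T) + L * a * \<sigma>\<^sup>2\<close> over positive
        \<open>a\<close> by making the two terms equal; \<open>s\<close> is their common
        value.\<close>
      define s where "s = \<sigma> * sqrt (2 * L * \<Delta> / real T)"
      have a_s: "L * \<sigma>\<^sup>2 * ?a = s"
      proof (rule power2_eq_imp_eq)
        show "(L * \<sigma>\<^sup>2 * ?a)\<^sup>2 = s\<^sup>2"
          using \<Delta> L_pos T \<sigma>_pos by (simp add: s_def power_mult_distrib field_simps power2_eq_square)
      qed (use nonneg L_pos \<sigma>_pos \<Delta> in \<open>auto simp: s_def\<close>)
      have "2 * \<Delta> / (?a * real T) = L * \<sigma>\<^sup>2 * ?a"
      proof -
        have "L * \<sigma>\<^sup>2 * real T * ?a\<^sup>2 = 2 * \<Delta>"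
          using \<Delta> L_pos T \<sigma>_pos by simp
        then show ?thesis
          using pos T by (simp add: divide_eq_eq power2_eq_square mult_ac)
      qed
      then have "1 / real T * (\<Sum>t<T. ?E t) \<le> s + \<delta>\<^sup>2 + s"
        using mean[OF pos small \<alpha>] a_s by (simp add: mult_ac)
      \<comment> \<open>The two equal terms add up to \<open>2 * s\<close>, and the factor 2 enters
        the square root as 4.\<close>
      moreover have "sqrt (8 * L * \<Delta> / real T) = 2 * sqrt (2 * L * \<Delta> / real T)"
        using real_sqrt_mult[of 4 "2 * L * \<Delta> / real T"] by (simp add: mult.assoc)
      ultimately show ?thesis by (simp add: s_def)
    qed
  qed
qed

end
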